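(* Let $A, B_2, C_2$ be real matrices of compatible sizes with $(A,B_2)$ stabilizable and $(A,C_2)$ detectable, let $\mathbf{P}_{22}=C_2(zI-A)^{-1}B_2$ (strictly proper), and let $\mathbf{U}_r,\mathbf{V}_r,\mathbf{U}_l,\mathbf{V}_l,\mathbf{M}_r,\mathbf{M}_l,\mathbf{N}_r,\mathbf{N}_l$ be any doubly-coprime factorization of $\mathbf{P}_{22}$. The following statements hold. (1) For any $\mathbf{Q}\in\mathcal{RH}_\infty$, the transfer matrices $$\mathbf{R}=(zI-A)^{-1}+(zI-A)^{-1}B_2(\mathbf{V}_r-\mathbf{M}_r\mathbf{Q})\mathbf{M}_lC_2(zI-A)^{-1},$$ $$\mathbf{M}=(\mathbf{V}_r-\mathbf{M}_r\mathbf{Q})\mathbf{M}_lC_2(zI-A)^{-1},\quad \mathbf{N}=(zI-A)^{-1}B_2(\mathbf{V}_r-\mathbf{M}_r\mathbf{Q})\mathbf{M}_l,\quad \mathbf{L}=(\mathbf{V}_r-\mathbf{M}_r\mathbf{Q})\mathbf{M}_l$$ satisfy the SLP constraints $$\begin{bmatrix}zI-A & -B_2\end{bmatrix}\begin{bmatrix}\mathbf{R}&\mathbf{N}\\ \mathbf{M}&\mathbf{L}\end{bmatrix}=\begin{bmatrix}I&0\end{bmatrix},\quad \begin{bmatrix}\mathbf{R}&\mathbf{N}\\ \mathbf{M}&\mathbf{L}\end{bmatrix}\begin{bmatrix}zI-A\\-C_2\end{bmatrix}=\begin{bmatrix}I\\0\end{bmatrix},\quad \mathbf{R},\mathbf{M},\mathbf{N}\in\tfrac1z\mathcal{RH}_\infty,\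 \mathbf{L}\in\mathcal{RH}_\infty,$$ and $\mathbf{L}-\mathbf{M}\mathbf{R}^{-1}\mathbf{N}=(\mathbf{V}_r-\mathbf{M}_r\mathbf{Q})(\mathbf{U}_r-\mathbf{N}_r\mathbf{Q})^{-1}$. (2) For any $(\mathbf{R},\mathbf{M},\mathbf{N},\mathbf{L})$ satisfying the SLP constraints displayed in (1), the transfer matrix $$\mathbf{Q}=\mathbf{V}_lC_2\mathbf{N}\mathbf{U}_r-\mathbf{U}_l\mathbf{L}\mathbf{U}_r-\mathbf{V}_lC_2\mathbf{R}B_2\mathbf{V}_r+\mathbf{U}_l\mathbf{M}B_2\mathbf{V}_r+\mathbf{U}_l\mathbf{V}_r$$ is such that $\mathbf{Q}\in\mathcal{RH}_\infty$ and $(\mathbf{V}_r-\mathbf{M}_r\mathbf{Q})(\mathbf{U}_r-\mathbf{N}_r\mathbf{Q})^{-1}=\mathbf{L}-\mathbf{M}\mathbf{R}^{-1}\mathbf{N}$.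
   Context: Discrete-time setting: transfer matrices are matrices of real-rational functions of $z$. $\mathcal{RH}_\infty$ denotes the set of real-rational, proper, stable transfer matrices (all poles in the open unit disk), of whatever size is required; $\tfrac1z\mathcal{RH}_\infty$ denotes the stable and strictly proper ones. Stabilizability and detectability are meant in the discrete-time sense. Doubly-coprime factorization of $\mathbf{P}_{22}$: a collection $\mathbf{U}_l,\mathbf{V}_l,\mathbf{N}_l,\mathbf{M}_l,\mathbf{U}_r,\mathbf{V}_r,\mathbf{N}_r,\mathbf{M}_r\in\mathcal{RH}_\infty$ such that $\mathbf{P}_{22}=\mathbf{N}_r\mathbf{M}_r^{-1}=\mathbf{M}_l^{-1}\mathbf{N}_l$ and $$\begin{bmatrix}\mathbf{U}_l&-\mathbf{V}_l\\-\mathbf{N}_l&\mathbf{M}_l\end{bmatrix}\begin{bmatrix}\mathbf{M}_r&\mathbf{V}_r\\ \mathbf{N}_r&\mathbf{U}_r\end{bmatrix}=I.$$ *)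

theory Defs
  imports
    "HOL-Computational_Algebra.Field_as_Ring"
    "HOL-Computational_Algebra.Normalized_Fraction"
    "HOL-Computational_Algebra.Polynomial_Factorial"
    "Jordan_Normal_Form.Char_Poly"
    "Jordan_Normal_Form.Gauss_Jordan_Elimination"
begin

type_synonym ratfun = "real poly fract"

definition zvar :: ratfun where
  "zvar = Fraction_Field.Fract [:0, 1:] 1"

definition const_tm :: "real mat \<Rightarrow> ratfun mat" where
  "const_tm A = map_mat (\<lambda>a. Fraction_Field.Fract [:a:] 1) A"

text \<open>\<open>quot_of_fract\<close> is the reduced representation (coprime numerator, monic denominator),
  so the poles are exactly the complex zeros of its second component. Properness is finiteness
  at infinity, expressed by the degrees.\<close>

definition poles :: "ratfun \<Rightarrow> complex set" where
  "poles f = {w. poly (map_poly complex_of_real (snd (quot_of_fract f))) w = 0}"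

definition stable :: "ratfun \<Rightarrow> bool" where
  "stable f \<longleftrightarrow> (\<forall>w \<in> poles f. cmod w < 1)"

definition proper :: "ratfun \<Rightarrow> bool" where
  "proper f \<longleftrightarrow> degree (fst (quot_of_fract f)) \<le> degree (snd (quot_of_fract f))"

definition strictly_proper :: "ratfun \<Rightarrow> bool" where
  "strictly_proper f \<longleftrightarrow> f = 0 \<or> degree (fst (quot_of_fract f)) < degree (snd (quot_of_fract f))"

definition RH_inf :: "nat \<Rightarrow> nat \<Rightarrow> ratfun mat set" where
  "RH_inf r c = {X \<in> carrier_mat r c. \<forall>i<r. \<forall>j<c. proper (X $$ (i, j)) \<and> stable (X $$ (i, j))}"

text \<open>This is \<open>(1/z) RH_inf\<close>.\<close>

definition sRH_inf :: "nat \<Rightarrow> nat \<Rightarrow> ratfun mat set" where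
  "sRH_inf r c =
     {X \<in> carrier_mat r c. \<forall>i<r. \<forall>j<c. strictly_proper (X $$ (i, j)) \<and> stable (X $$ (i, j))}"

text \<open>Only meaningful for matrices satisfying \<open>invertible_mat\<close>.\<close>

definition mat_inv :: "'a::field mat \<Rightarrow> 'a mat" where
  "mat_inv X = the (mat_inverse X)"

definition append_cols :: "'a::zero mat \<Rightarrow> 'a mat \<Rightarrow> 'a mat" (infixr "@\<^sub>c" 65) where
  "X @\<^sub>c Y = four_block_mat X Y (0\<^sub>m 0 (dim_col X)) (0\<^sub>m 0 (dim_col Y))"

definition zI_minus :: "real mat \<Rightarrow> ratfun mat" where
  "zI_minus A = zvar \<cdot>\<^sub>m 1\<^sub>m (dim_row A) - const_tm A"

definition schur_stable :: "real mat \<Rightarrow> bool" where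
  "schur_stable A \<longleftrightarrow> (\<forall>w. eigenvalue (map_mat complex_of_real A) w \<longrightarrow> cmod w < 1)"

text \<open>Sizes below: \<open>n\<close> states, \<open>m\<close> inputs, \<open>p\<close> outputs.\<close>

definition stabilizable :: "real mat \<Rightarrow> real mat \<Rightarrow> bool" where
  "stabilizable A B \<longleftrightarrow>
     (\<exists>F \<in> carrier_mat (dim_col B) (dim_row A). schur_stable (A + B * F))"

definition detectable :: "real mat \<Rightarrow> real mat \<Rightarrow> bool" where
  "detectable A C \<longleftrightarrow>
     (\<exists>H \<in> carrier_mat (dim_row A) (dim_row C). schur_stable (A + H * C))"

definition doubly_coprime_factorization ::
  "nat \<Rightarrow> nat \<Rightarrow> ratfun mat \<Rightarrow>
   ratfun mat \<Rightarrow> ratfun mat \<Rightarrow> ratfun mat \<Rightarrow> ratfun mat \<Rightarrow>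
   ratfun mat \<Rightarrow> ratfun mat \<Rightarrow> ratfun mat \<Rightarrow> ratfun mat \<Rightarrow> bool" where
  "doubly_coprime_factorization p m P Ul Vl Nl Ml Ur Vr Nr Mr \<longleftrightarrow>
     Ul \<in> RH_inf m m \<and> Vl \<in> RH_inf m p \<and> Nl \<in> RH_inf p m \<and> Ml \<in> RH_inf p p \<and>
     Ur \<in> RH_inf p p \<and> Vr \<in> RH_inf m p \<and> Nr \<in> RH_inf p m \<and> Mr \<in> RH_inf m m \<and>
     invertible_mat Mr \<and> P = Nr * mat_inv Mr \<and>
     invertible_mat Ml \<and> P = mat_inv Ml * Nl \<and>
     four_block_mat Ul (- Vl) (- Nl) Ml * four_block_mat Mr Vr Nr Ur = 1\<^sub>m (m + p)"

definition slp_constraints ::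
  "nat \<Rightarrow> nat \<Rightarrow> nat \<Rightarrow> real mat \<Rightarrow> real mat \<Rightarrow> real mat \<Rightarrow>
   ratfun mat \<Rightarrow> ratfun mat \<Rightarrow> ratfun mat \<Rightarrow> ratfun mat \<Rightarrow> bool" where
  "slp_constraints n m p A B2 C2 R M N L \<longleftrightarrow>
     R \<in> sRH_inf n n \<and> M \<in> sRH_inf m n \<and> N \<in> sRH_inf n p \<and> L \<in> RH_inf m p \<and>
     (zI_minus A @\<^sub>c - const_tm B2) * four_block_mat R N M L = 1\<^sub>m n @\<^sub>c 0\<^sub>m n p \<and>
     four_block_mat R N M L * (zI_minus A @\<^sub>r - const_tm C2) = 1\<^sub>m n @\<^sub>r 0\<^sub>m m n"

end

theory Submission
  imports Defs
begin

text \<open>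
  Write \<open>\<Phi> = (zI - A)\<^sup>-\<^sup>1\<close>. If \<open>Y (zI - A)\<close> and \<open>Y B\<^sub>2\<close> are stable, then so is
  \<open>Y (zI - A - B\<^sub>2 F)\<close>, and a stabilizing \<open>F\<close> yields \<open>Y \<in> (1/z) RH\<^sub>\<infinity>\<close>; dually for detectability.
  Thus \<open>M\<^sub>l C\<^sub>2 \<Phi>\<close> and \<open>\<Phi> B\<^sub>2 M\<^sub>r\<close> are stable and strictly proper, and with the reversed Bezout
  identity, in particular \<open>V\<^sub>r M\<^sub>l = M\<^sub>r V\<^sub>l\<close>, this gives stability of \<open>R, M, N, L\<close> in part (1).
  Conversely, the SLP constraints force \<open>M = L C\<^sub>2 \<Phi>\<close>, \<open>N = \<Phi> B\<^sub>2 L\<close>, \<open>R = \<Phi> + \<Phi> B\<^sub>2 L C\<^sub>2 \<Phi>\<close>, and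
  the \<open>Q\<close> of part (2) satisfies \<open>L = (V\<^sub>r - M\<^sub>r Q) M\<^sub>l\<close>, so both parts share the computation of the
  controller. All inverses exist because \<open>I + S\<close> is invertible for strictly proper \<open>S\<close>:
  \<open>(zI - A) R = I + B\<^sub>2 M\<close> and \<open>M\<^sub>l (U\<^sub>r - N\<^sub>r Q) = I + N\<^sub>l (V\<^sub>r - M\<^sub>r Q)\<close>.
\<close>

subsection \<open>Degree and stability of rational functions\<close>

definition deg_le :: "int \<Rightarrow> ratfun \<Rightarrow> bool" where
  "deg_le k f \<longleftrightarrow>
     f = 0 \<or> int (degree (fst (quot_of_fract f))) \<le> int (degree (snd (quot_of_fract f))) + k"

text \<open>Cross multiplication of two representations shows that the difference of degrees does
  not depend on the one chosen, so bounds can be read off unreduced fractions.\<close>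

lemma deg_le_Fract:
  assumes "b \<noteq> 0"
  shows "deg_le k (Fraction_Field.Fract a b) \<longleftrightarrow> a = 0 \<or> int (degree a) \<le> int (degree b) + k"
proof (cases "a = 0")
  case True
  then have "Fraction_Field.Fract a b = 0" using assms by (simp add: Zero_fract_def eq_fract)
  then show ?thesis using True by (simp add: deg_le_def)
next
  case False
  let ?f = "Fraction_Field.Fract a b"
  define c d where "c = fst (quot_of_fract ?f)" and "d = snd (quot_of_fract ?f)"
  have d0: "d \<noteq> 0" by (simp add: d_def)
  have eq: "Fraction_Field.Fract c d = Fraction_Field.Fract a b" by (simp add: c_def d_def)
  then have "c * b = a * d" using assms d0 by (simp add: eq_fract)
  moreover have f0: "?f \<noteq> 0" using False assms by (simp add: Zero_fract_def eq_fract)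
  then have c0: "c \<noteq> 0" by (simp add: c_def)
  ultimately have "degree c + degree b = degree a + degree d"
    using assms d0 False by (metis degree_mult_eq)
  then show ?thesis using f0 False unfolding deg_le_def c_def[symmetric] d_def[symmetric] by auto
qed

lemma ratfun_cases:
  obtains a b where "f = Fraction_Field.Fract a (b :: real poly)" "b \<noteq> 0"
  by (metis Fract_quot_of_fract snd_quot_of_fract_nonzero)

lemma proper_iff_deg_le: "proper f \<longleftrightarrow> deg_le 0 f"
  by (auto simp: proper_def deg_le_def)

lemma strictly_proper_iff_deg_le: "strictly_proper f \<longleftrightarrow> deg_le (-1) f"
  by (auto simp: strictly_proper_def deg_le_def)

lemma deg_le_zero [simp]: "deg_le k 0"
  by (simp add: deg_le_def)

lemma deg_le_mono: "deg_le k f \<Longrightarrow> k \<le> l \<Longrightarrow> deg_le l f"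
  by (auto simp: deg_le_def)

lemma deg_le_uminus: "deg_le k f \<Longrightarrow> deg_le k (- f)"
  by (cases f rule: ratfun_cases) (auto simp: deg_le_Fract)

lemma deg_le_mult:
  assumes "deg_le k f" "deg_le l g"
  shows "deg_le (k + l) (f * g)"
proof -
  obtain a b where f: "f = Fraction_Field.Fract a b" "b \<noteq> 0" by (rule ratfun_cases)
  obtain c d where g: "g = Fraction_Field.Fract c d" "d \<noteq> 0" by (rule ratfun_cases)
  show ?thesis
    using assms f g by (auto simp: deg_le_Fract degree_mult_eq)
qed

lemma deg_le_add:
  assumes "deg_le k f" "deg_le k g"
  shows "deg_le k (f + g)"
proof -
  obtain a b where f: "f = Fraction_Field.Fract a b" "b \<noteq> 0" by (rule ratfun_cases)
  obtain c d where g: "g = Fraction_Field.Fract c d" "d \<noteq> 0" by (rule ratfun_cases)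
  have 1: "a * d = 0 \<or> int (degree (a * d)) \<le> int (degree (b * d)) + k"
    and 2: "c * b = 0 \<or> int (degree (c * b)) \<le> int (degree (b * d)) + k"
    using assms f g by (auto simp: deg_le_Fract degree_mult_eq)
  have "a * d + c * b = 0 \<or> int (degree (a * d + c * b)) \<le> int (degree (b * d)) + k"
    using 1 2 degree_add_le_max[of "a * d" "c * b"] by (cases "a * d = 0"; cases "c * b = 0") auto
  then show ?thesis using f g by (simp add: deg_le_Fract)
qed

lemma deg_le_sum: "(\<And>i. i \<in> I \<Longrightarrow> deg_le k (f i)) \<Longrightarrow> deg_le k (sum f I)"
  by (induction I rule: infinite_finite_induct) (auto intro: deg_le_add)

text \<open>For nonzero \<open>f\<close> this is the least \<open>k\<close> with
  \<open>deg_le k f\<close>, so that entries can be compared by degree. The value at 0 carries no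
  such meaning, and 0 is always treated apart.\<close>

definition rdeg :: "ratfun \<Rightarrow> int" where
  "rdeg f = int (degree (fst (quot_of_fract f))) - int (degree (snd (quot_of_fract f)))"

lemma deg_le_iff_rdeg: "deg_le k f \<longleftrightarrow> f = 0 \<or> rdeg f \<le> k"
  by (auto simp: deg_le_def rdeg_def)

text \<open>An entry of maximal degree cannot exceed the bound on \<open>w\<close>, since \<open>s\<close> lowers degrees.\<close>

lemma deg_le_fixpoint:
  fixes n :: nat
  assumes eq: "\<And>i. i < n \<Longrightarrow> y i = w i + (\<Sum>j<n. s i j * y j)"
    and s: "\<And>i j. i < n \<Longrightarrow> j < n \<Longrightarrow> deg_le (-1) (s i j)"
    and w: "\<And>i. i < n \<Longrightarrow> deg_le k (w i)"
    and i: "i < n"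
  shows "deg_le k (y i)"
proof (rule ccontr)
  assume neg: "\<not> deg_le k (y i)"
  \<comment> \<open>Zero entries are left out, since \<open>rdeg\<close> says nothing about them.
    The set contains \<open>i\<close> because 0 satisfies every bound.\<close>
  define J where "J = {i. i < n \<and> y i \<noteq> 0}"
  have iJ: "i \<in> J" using neg i by (auto simp: J_def)
  have fin: "finite J" by (rule finite_subset[of _ "{..<n}"]) (auto simp: J_def)
  have "Max ((\<lambda>j. rdeg (y j)) ` J) \<in> (\<lambda>j. rdeg (y j)) ` J"
    using iJ fin by (intro Max_in) auto
  then obtain t where t: "t \<in> J" and "rdeg (y t) = Max ((\<lambda>j. rdeg (y j)) ` J)" by auto
  then have max: "rdeg (y j) \<le> rdeg (y t)" if "j \<in> J" for j
    using fin that by simp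
  have gt: "k < rdeg (y t)"
    using max[OF iJ] neg by (auto simp: deg_le_iff_rdeg)
  let ?l = "rdeg (y t) - 1"
  have tn: "t < n" using t by (simp add: J_def)
  have "deg_le ?l (s t j * y j)" if "j < n" for j
  proof -
    have "deg_le (rdeg (y t)) (y j)"
      using max[of j] that by (auto simp: deg_le_iff_rdeg J_def)
    then show ?thesis using deg_le_mult[OF s[OF tn that]] by fastforce
  qed
  then have "deg_le ?l (\<Sum>j<n. s t j * y j)" by (intro deg_le_sum) auto
  moreover have "deg_le ?l (w t)" using w[OF tn] gt by (auto intro: deg_le_mono)
  ultimately have "deg_le ?l (y t)" using eq[OF tn] deg_le_add by metis
  then show False using t by (auto simp: deg_le_iff_rdeg J_def)
qed

section \<open>Stability read off from an arbitrary denominator\<close>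

definition disk_roots :: "real poly \<Rightarrow> bool" where
  "disk_roots b \<longleftrightarrow> (\<forall>w. poly (map_poly complex_of_real b) w = 0 \<longrightarrow> cmod w < 1)"

lemma poly_of_real_mult:
  "poly (map_poly complex_of_real (b * d)) w =
     poly (map_poly complex_of_real b) w * poly (map_poly complex_of_real d) w"
proof -
  interpret h: map_poly_comm_ring_hom complex_of_real ..
  show ?thesis by (simp add: h.hom_mult)
qed

lemma disk_roots_one [simp]: "disk_roots 1"
  by (simp add: disk_roots_def)

lemma disk_roots_mult: "disk_roots b \<Longrightarrow> disk_roots d \<Longrightarrow> disk_roots (b * d)"
  by (auto simp: disk_roots_def poly_of_real_mult)

text \<open>Cancellation only removes poles: the reduced denominator \<open>d\<close> divides
  \<open>c * b\<close> and is coprime to \<open>c\<close>, hence divides \<open>b\<close>.\<close>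

lemma stable_Fract:
  assumes "b \<noteq> 0" "disk_roots b"
  shows "stable (Fraction_Field.Fract a b)"
proof -
  let ?f = "Fraction_Field.Fract a b"
  define c d where "c = fst (quot_of_fract ?f)" and "d = snd (quot_of_fract ?f)"
  have d0: "d \<noteq> 0" by (simp add: d_def)
  have "Fraction_Field.Fract c d = Fraction_Field.Fract a b" by (simp add: c_def d_def)
  then have "c * b = a * d" using assms(1) d0 by (simp add: eq_fract)
  then have "d dvd c * b" by simp
  moreover have "coprime d c"
    using coprime_quot_of_fract[of ?f] by (simp add: c_def d_def coprime_commute)
  ultimately have "d dvd b" by (simp add: coprime_dvd_mult_right_iff)
  then obtain e where "b = d * e" by (rule dvdE)
  then have "disk_roots d" using assms(2) by (auto simp: disk_roots_def poly_of_real_mult)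
  then show ?thesis by (auto simp: disk_roots_def stable_def poles_def d_def)
qed

lemma stableE:
  assumes "stable f"
  obtains a b where "f = Fraction_Field.Fract a b" "b \<noteq> 0" "disk_roots b"
proof (rule that)
  show "f = Fraction_Field.Fract (fst (quot_of_fract f)) (snd (quot_of_fract f))" by simp
  show "disk_roots (snd (quot_of_fract f))"
    using assms by (simp add: stable_def poles_def disk_roots_def)
qed simp

lemma stable_zero [simp]: "stable 0"
  by (simp add: stable_def poles_def)

lemma stable_uminus: "stable f \<Longrightarrow> stable (- f)"
  by (erule stableE) (simp add: stable_Fract)

lemma stable_mult:
  assumes "stable f" "stable g"
  shows "stable (f * g)"
proof -
  from assms(1) obtain a b where "f = Fraction_Field.Fract a b" "b \<noteq> 0" "disk_roots b"
    by (rule stableE)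
  moreover from assms(2) obtain c d where "g = Fraction_Field.Fract c d" "d \<noteq> 0" "disk_roots d"
    by (rule stableE)
  ultimately show ?thesis by (simp add: stable_Fract disk_roots_mult)
qed

lemma stable_add:
  assumes "stable f" "stable g"
  shows "stable (f + g)"
proof -
  from assms(1) obtain a b where "f = Fraction_Field.Fract a b" "b \<noteq> 0" "disk_roots b"
    by (rule stableE)
  moreover from assms(2) obtain c d where "g = Fraction_Field.Fract c d" "d \<noteq> 0" "disk_roots d"
    by (rule stableE)
  ultimately show ?thesis by (simp add: stable_Fract disk_roots_mult)
qed

lemma stable_sum: "(\<And>i. i \<in> I \<Longrightarrow> stable (f i)) \<Longrightarrow> stable (sum f I)"
  by (induction I rule: infinite_finite_induct) (auto intro: stable_add)

subsection \<open>Matrices of stable rational functions\<close>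

text \<open>Treats \<open>RH_inf\<close> (\<open>k = 0\<close>) and \<open>sRH_inf\<close>
  (\<open>k = -1\<close>) as one graded family, so closure under sums and products is proved once;
  one strictly proper factor makes a product of proper matrices strictly proper.\<close>

definition stable_mats :: "int \<Rightarrow> nat \<Rightarrow> nat \<Rightarrow> ratfun mat set" where
  "stable_mats k r c =
     {X \<in> carrier_mat r c. \<forall>i<r. \<forall>j<c. deg_le k (X $$ (i, j)) \<and> stable (X $$ (i, j))}"

lemma RH_inf_eq: "RH_inf = stable_mats 0"
  by (auto simp: RH_inf_def stable_mats_def proper_iff_deg_le fun_eq_iff)

lemma sRH_inf_eq: "sRH_inf = stable_mats (-1)"
  by (auto simp: sRH_inf_def stable_mats_def strictly_proper_iff_deg_le fun_eq_iff)

lemma stable_mats_carrier: "X \<in> stable_mats k r c \<Longrightarrow> X \<in> carrier_mat r c"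
  by (simp add: stable_mats_def)

lemma stable_mats_mono: "X \<in> stable_mats k r c \<Longrightarrow> k \<le> l \<Longrightarrow> X \<in> stable_mats l r c"
  by (auto simp: stable_mats_def intro: deg_le_mono)

lemma stable_mats_add:
  "X \<in> stable_mats k r c \<Longrightarrow> Y \<in> stable_mats k r c \<Longrightarrow> X + Y \<in> stable_mats k r c"
  by (auto simp: stable_mats_def deg_le_add stable_add)

lemma stable_mats_uminus: "X \<in> stable_mats k r c \<Longrightarrow> - X \<in> stable_mats k r c"
  by (auto simp: stable_mats_def deg_le_uminus stable_uminus)

lemma stable_mats_minus:
  assumes "X \<in> stable_mats k r c" "Y \<in> stable_mats k r c"
  shows "X - Y \<in> stable_mats k r c"
  using stable_mats_add[OF assms(1) stable_mats_uminus[OF assms(2)]] assms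
  by (metis add_uminus_minus_mat stable_mats_carrier)

lemma stable_mats_mult:
  assumes "X \<in> stable_mats k r s" "Y \<in> stable_mats l s t"
  shows "X * Y \<in> stable_mats (k + l) r t"
  using assms
  by (auto simp: stable_mats_def scalar_prod_def
        intro!: deg_le_sum stable_sum deg_le_mult stable_mult)

section \<open>Constant matrices, the pencil \<open>zI - A\<close> and its inverse\<close>

lemma const_tm_carrier [simp]: "A \<in> carrier_mat r c \<Longrightarrow> const_tm A \<in> carrier_mat r c"
  by (simp add: const_tm_def)

lemma const_tm_dim [simp]: "dim_row (const_tm A) = dim_row A" "dim_col (const_tm A) = dim_col A"
  by (simp_all add: const_tm_def)

lemma const_tm_stable_mats: "A \<in> carrier_mat r c \<Longrightarrow> const_tm A \<in> stable_mats 0 r c"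
  by (auto simp: stable_mats_def const_tm_def deg_le_Fract intro!: stable_Fract)

lemma one_stable_mats: "1\<^sub>m r \<in> stable_mats 0 r r"
proof -
  have "deg_le 0 1" "stable 1"
    by (simp_all add: One_fract_def deg_le_Fract stable_Fract)
  then show ?thesis by (auto simp: stable_mats_def)
qed

lemma const_tm_mult:
  assumes "A \<in> carrier_mat r s" "B \<in> carrier_mat s t"
  shows "const_tm (A * B) = const_tm A * const_tm B"
proof -
  interpret h: semiring_hom "\<lambda>a. Fraction_Field.Fract [:a::real:] 1"
    by unfold_locales (auto simp: Zero_fract_def One_fract_def one_pCons mult.commute)
  show ?thesis unfolding const_tm_def by (rule h.mat_hom_mult[OF assms])
qed

lemma const_tm_add:
  assumes "A \<in> carrier_mat r s" "B \<in> carrier_mat r s"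
  shows "const_tm (A + B) = const_tm A + const_tm B"
  using assms by (intro eq_matI) (auto simp: const_tm_def)

lemma zI_minus_carrier [simp]: "A \<in> carrier_mat n n \<Longrightarrow> zI_minus A \<in> carrier_mat n n"
  by (auto simp: zI_minus_def intro!: minus_carrier_mat)

lemma zI_minus_dim [simp]: "dim_row (zI_minus A) = dim_row A" "dim_col (zI_minus A) = dim_col A"
  by (simp_all add: zI_minus_def)

text \<open>Makes determinant and adjugate of the polynomial characteristic matrix available for the
  pencil through the ring embedding \<open>to_fract\<close>.\<close>

lemma zI_minus_char_poly_matrix:
  assumes "A \<in> carrier_mat n n"
  shows "zI_minus A = map_mat to_fract (char_poly_matrix A)"
  using assms
  by (intro eq_matI)
    (auto simp: zI_minus_def char_poly_matrix_def const_tm_def zvar_def to_fract_def one_pCons)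

lemma det_zI_minus:
  assumes "A \<in> carrier_mat n n"
  shows "det (zI_minus A) = to_fract (char_poly A)"
proof -
  interpret h: comm_ring_hom "to_fract :: real poly \<Rightarrow> ratfun"
    by unfold_locales (auto simp: to_fract_def Zero_fract_def One_fract_def)
  show ?thesis using assms
    by (simp add: zI_minus_char_poly_matrix h.hom_det char_poly_def)
qed

lemma char_poly_nonzero: "A \<in> carrier_mat n n \<Longrightarrow> char_poly A \<noteq> 0"
  using degree_monic_char_poly[of A n] by auto

text \<open>Invertibility places \<open>X\<close> among the units of the matrix ring, which rules
  out the result \<open>None\<close> of \<open>mat_inverse\<close>, so \<open>the\<close> is
  harmless.\<close>

lemma mat_inv_props:
  fixes X :: "'a::field mat"
  assumes X: "X \<in> carrier_mat n n" and inv: "invertible_mat X"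
  shows "mat_inv X \<in> carrier_mat n n" "X * mat_inv X = 1\<^sub>m n" "mat_inv X * X = 1\<^sub>m n"
proof -
  obtain Y where Y: "X * Y = 1\<^sub>m n" "Y * X = 1\<^sub>m (dim_row Y)"
    using X inv unfolding invertible_mat_def inverts_mat_def by auto
  \<comment> \<open>The size of \<open>Y\<close> is not part of the definition of invertibility; the
    two product equations determine it.\<close>
  have "Y \<in> carrier_mat n n"
    using X Y by (metis carrier_matD carrier_matI index_mult_mat(2,3) index_one_mat(2,3))
  then have "X \<in> Units (ring_mat TYPE('a) n ())"
    using X Y unfolding Units_def ring_mat_def by auto
  then obtain B where "mat_inverse X = Some B"
    using mat_inverse(1)[OF X, of "()"] by (cases "mat_inverse X") auto
  then show "mat_inv X \<in> carrier_mat n n" "X * mat_inv X = 1\<^sub>m n" "mat_inv X * X = 1\<^sub>m n"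
    using mat_inverse(2)[OF X, of B] by (auto simp: mat_inv_def)
qed

lemma invertible_mat_right:
  fixes X :: "'a::field mat"
  assumes "X \<in> carrier_mat n n" "Y \<in> carrier_mat n n" "X * Y = 1\<^sub>m n"
  shows "invertible_mat X"
  using assms mat_mult_left_right_inverse[OF assms]
  unfolding invertible_mat_def inverts_mat_def by auto

lemma invertible_mat_iff_det:
  fixes X :: "'a::field mat"
  assumes X: "X \<in> carrier_mat n n"
  shows "invertible_mat X \<longleftrightarrow> det X \<noteq> 0"
proof
  assume "invertible_mat X"
  from mat_inv_props[OF X this] have "det X * det (mat_inv X) = 1"
    using X by (metis det_mult det_one)
  then show "det X \<noteq> 0" by auto
next
  assume "det X \<noteq> 0"
  from det_non_zero_imp_unit[OF X this, of "()"] show "invertible_mat X"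
    unfolding Units_def ring_mat_def using invertible_mat_right[OF X] by auto
qed

text \<open>Eigenvalues do not matter here: the determinant is the characteristic polynomial, which
  is monic and thus nonzero as a rational function.\<close>

lemma zI_minus_invertible: "A \<in> carrier_mat n n \<Longrightarrow> invertible_mat (zI_minus A)"
  by (simp add: invertible_mat_iff_det[OF zI_minus_carrier] det_zI_minus char_poly_nonzero)

text \<open>At infinity the matrix tends to the identity. Algebraically, a kernel vector satisfies
  \<open>v = - S v\<close>, which is impossible for a nonzero entry of largest degree.\<close>

lemma invertible_one_plus_strictly_proper:
  assumes S: "S \<in> stable_mats (-1) n n"
  shows "invertible_mat (1\<^sub>m n + S)"
proof -
  have Sc: "S \<in> carrier_mat n n" by (rule stable_mats_carrier[OF S])
  have "det (1\<^sub>m n + S) \<noteq> 0"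
  proof
    assume "det (1\<^sub>m n + S) = 0"
    then obtain v where v: "v \<in> carrier_vec n" "v \<noteq> 0\<^sub>v n" "(1\<^sub>m n + S) *\<^sub>v v = 0\<^sub>v n"
      using det_0_iff_vec_prod_zero[of "1\<^sub>m n + S" n] Sc by auto
    then have sum0: "v + S *\<^sub>v v = 0\<^sub>v n"
      using Sc by (simp add: add_mult_distrib_mat_vec[of _ n n])
    have eq: "v $ i = 0 + (\<Sum>j<n. - S $$ (i, j) * v $ j)" if "i < n" for i
    proof -
      have "(v + S *\<^sub>v v) $ i = 0" using that by (simp add: sum0)
      moreover have "(v + S *\<^sub>v v) $ i = v $ i + (\<Sum>j<n. S $$ (i, j) * v $ j)"
        using that Sc v(1) by (simp add: scalar_prod_def lessThan_atLeast0)
      ultimately show ?thesis by (simp add: sum_negf eq_neg_iff_add_eq_0)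
    qed
    have "v $ i = 0" if "i < n" for i
    proof -
      \<comment> \<open>With \<open>w = 0\<close> the bound \<open>k\<close> is free; choosing it
        one below the relative degree of the entry itself forces that entry to be 0.\<close>
      have "deg_le (rdeg (v $ i) - 1) (v $ i)"
        by (rule deg_le_fixpoint[OF eq])
          (use that S in \<open>auto simp: stable_mats_def deg_le_uminus\<close>)
      then show ?thesis by (auto simp: deg_le_iff_rdeg)
    qed
    then show False using v by auto
  qed
  then show ?thesis using invertible_mat_iff_det[of "1\<^sub>m n + S" n] Sc by auto
qed

text \<open>Stability comes from the adjugate formula, whose denominator has the eigenvalues of
  \<open>A\<close> as roots. Strict properness is obtained without counting adjugate degrees, from
  \<open>z \<Phi> = I + A \<Phi>\<close>.\<close>

lemma mat_inv_zI_minus_stable: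
  assumes A: "A \<in> carrier_mat n n" and schur: "schur_stable A"
  shows "mat_inv (zI_minus A) \<in> stable_mats (-1) n n"
proof -
  define \<Phi> where "\<Phi> = mat_inv (zI_minus A)"
  note \<Phi> = mat_inv_props[OF zI_minus_carrier[OF A] zI_minus_invertible[OF A], folded \<Phi>_def]
  let ?M = "char_poly_matrix A"
  have M: "?M \<in> carrier_mat n n" using A by simp
  have disk: "disk_roots (char_poly A)"
    using schur eigenvalue_root_char_poly[of "map_mat complex_of_real A" n] A
    unfolding schur_stable_def disk_roots_def by (auto simp: of_real_hom.char_poly_hom)
  interpret h: comm_ring_hom "to_fract :: real poly \<Rightarrow> ratfun"
    by unfold_locales (auto simp: to_fract_def Zero_fract_def One_fract_def)
  \<comment> \<open>Embedding the polynomial adjugate and cancelling \<open>zI_minus A\<close>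
    exhibits each entry of \<Phi> as an adjugate entry over the characteristic polynomial.\<close>
  define adj where "adj = map_mat to_fract (adj_mat ?M)"
  have adjc: "adj \<in> carrier_mat n n" using adj_mat(1)[OF M] by (simp add: adj_def)
  have "zI_minus A * adj = map_mat to_fract (?M * adj_mat ?M)"
    by (simp add: zI_minus_char_poly_matrix[OF A] adj_def h.mat_hom_mult[OF M adj_mat(1)[OF M]])
  also have "\<dots> = to_fract (char_poly A) \<cdot>\<^sub>m 1\<^sub>m n"
    unfolding adj_mat(2)[OF M] by (intro eq_matI) (auto simp: char_poly_def)
  finally have "\<Phi> * (zI_minus A * adj) = \<Phi> * (to_fract (char_poly A) \<cdot>\<^sub>m 1\<^sub>m n)" by simp
  then have adj: "adj = to_fract (char_poly A) \<cdot>\<^sub>m \<Phi>"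
    using \<Phi> adjc A
    by (subst (asm) assoc_mult_mat[symmetric, of _ n n _ n _ n]) (auto simp: mult_smult_distrib)
  have entry: "\<Phi> $$ (i, j) = Fraction_Field.Fract (adj_mat ?M $$ (i, j)) (char_poly A)"
    if "i < n" "j < n" for i j
  proof -
    have "to_fract (adj_mat ?M $$ (i, j)) = adj $$ (i, j)"
      using that adj_mat(1)[OF M] by (simp add: adj_def)
    also have "\<dots> = to_fract (char_poly A) * \<Phi> $$ (i, j)"
      using that \<Phi> by (simp add: adj)
    finally have "\<Phi> $$ (i, j) = to_fract (adj_mat ?M $$ (i, j)) / to_fract (char_poly A)"
      using char_poly_nonzero[OF A] by (simp add: field_simps)
    then show ?thesis by (simp add: to_fract_def)
  qed
  have deg: "deg_le (-1) (\<Phi> $$ (i, j))" if ij: "i < n" "j < n" for i j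
  \<comment> \<open>Column \<open>j\<close> of \<open>z \<Phi> = I + A \<Phi>\<close>, divided by
    \<open>z\<close>, is a fixpoint equation whose inhomogeneity and coefficients both have relative
    degree at most -1.\<close>
  proof (rule deg_le_fixpoint[where n = n and y = "\<lambda>i. \<Phi> $$ (i, j)"
        and w = "\<lambda>i. inverse zvar * 1\<^sub>m n $$ (i, j)"
        and s = "\<lambda>i k. inverse zvar * const_tm A $$ (i, k)"])
    have zinv: "inverse zvar = Fraction_Field.Fract 1 [:0, 1:]" by (simp add: zvar_def)
    have z0: "zvar \<noteq> 0" by (simp add: zvar_def Zero_fract_def eq_fract)
    have dz: "deg_le (-1) (inverse zvar)" by (simp add: zinv deg_le_Fract)
    fix i assume i: "i < n"
    have "(zI_minus A * \<Phi>) $$ (i, j) =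
        zvar * \<Phi> $$ (i, j) - (\<Sum>k<n. const_tm A $$ (i, k) * \<Phi> $$ (k, j))"
    proof -
      have "zI_minus A * \<Phi> = zvar \<cdot>\<^sub>m \<Phi> - const_tm A * \<Phi>"
        using A \<Phi>(1) unfolding zI_minus_def
        by (subst minus_mult_distrib_mat[of _ n n _ _ n]) (auto simp: mult_smult_assoc_mat[of _ n n _ n])
      then show ?thesis using A \<Phi>(1) i ij by (auto simp: scalar_prod_def lessThan_atLeast0)
    qed
    then have "zvar * \<Phi> $$ (i, j) = 1\<^sub>m n $$ (i, j) + (\<Sum>k<n. const_tm A $$ (i, k) * \<Phi> $$ (k, j))"
      by (simp add: \<Phi>(2) algebra_simps)
    then show "\<Phi> $$ (i, j) = inverse zvar * 1\<^sub>m n $$ (i, j) +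
        (\<Sum>k<n. inverse zvar * const_tm A $$ (i, k) * \<Phi> $$ (k, j))"
      using z0 by (simp add: field_simps sum_distrib_left)
    show "deg_le (-1) (inverse zvar * 1\<^sub>m n $$ (i, j))"
      using deg_le_mult[OF dz, of 0] one_stable_mats[of n] i ij by (auto simp: stable_mats_def)
    show "deg_le (-1) (inverse zvar * const_tm A $$ (i, k))" if "k < n" for k
      using deg_le_mult[OF dz, of 0] const_tm_stable_mats[OF A] i that
      by (auto simp: stable_mats_def)
  qed (use ij in auto)
  show ?thesis
    using \<Phi>(1) deg entry stable_Fract[OF char_poly_nonzero[OF A] disk]
    by (auto simp: stable_mats_def \<Phi>_def[symmetric])
qed

subsection \<open>Matrix algebra with dimension side conditions\<close>

text \<open>Here and below, dimension equations replace carrier memberships, so that rewriting needs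
  no choice of sizes.\<close>

lemma mat_assoc:
  fixes X Y Z :: "'a::semiring_0 mat"
  shows "dim_col X = dim_row Y \<Longrightarrow> dim_col Y = dim_row Z \<Longrightarrow> X * Y * Z = X * (Y * Z)"
  by (rule assoc_mult_mat[of _ "dim_row X" "dim_col X" _ "dim_col Y" _ "dim_col Z"]) auto

lemma mat_distrib_left:
  fixes X Y Z :: "'a::semiring_0 mat"
  shows "dim_col X = dim_row Y \<Longrightarrow> dim_row Y = dim_row Z \<Longrightarrow> dim_col Y = dim_col Z \<Longrightarrow>
    X * (Y + Z) = X * Y + X * Z"
  by (rule mult_add_distrib_mat[of _ "dim_row X" "dim_col X" _ "dim_col Y"]) auto

lemma mat_distrib_right:
  fixes X Y Z :: "'a::semiring_0 mat"
  shows "dim_row X = dim_row Y \<Longrightarrow> dim_col X = dim_col Y \<Longrightarrow> dim_col X = dim_row Z \<Longrightarrow>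
    (X + Y) * Z = X * Z + Y * Z"
  by (rule add_mult_distrib_mat[of _ "dim_row X" "dim_col X" _ _ "dim_col Z"]) auto

lemma mat_distrib_left_minus:
  fixes X Y Z :: "'a::ring mat"
  shows "dim_col X = dim_row Y \<Longrightarrow> dim_row Y = dim_row Z \<Longrightarrow> dim_col Y = dim_col Z \<Longrightarrow>
    X * (Y - Z) = X * Y - X * Z"
  by (rule mult_minus_distrib_mat[of _ "dim_row X" "dim_col X" _ "dim_col Y"]) auto

lemma mat_distrib_right_minus:
  fixes X Y Z :: "'a::ring mat"
  shows "dim_row X = dim_row Y \<Longrightarrow> dim_col X = dim_col Y \<Longrightarrow> dim_col X = dim_row Z \<Longrightarrow>
    (X - Y) * Z = X * Z - Y * Z"
  by (rule minus_mult_distrib_mat[of _ "dim_row X" "dim_col X" _ _ "dim_col Z"]) auto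

lemma mat_one_left: "dim_row X = k \<Longrightarrow> 1\<^sub>m k * X = (X :: 'a::semiring_1 mat)"
  by (rule left_mult_one_mat[of _ k "dim_col X"]) auto

lemma mat_one_right: "dim_col X = k \<Longrightarrow> X * 1\<^sub>m k = (X :: 'a::semiring_1 mat)"
  by (rule right_mult_one_mat[of _ "dim_row X" k]) auto

lemmas mat_ring =
  mat_assoc mat_distrib_left mat_distrib_right mat_distrib_left_minus mat_distrib_right_minus
  mat_one_left mat_one_right

text \<open>In right-nested products the pair \<open>X * Y\<close> is no longer a subterm; this form
  lets an identity for the pair act there.\<close>

lemma mat_mult_eq_assoc:
  fixes X Y Z T :: "'a::semiring_0 mat"
  assumes "X * Y = Z" "dim_col X = dim_row Y" "dim_col Y = dim_row T"
  shows "X * (Y * T) = Z * T"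
  using assms by (simp add: mat_assoc[symmetric])

lemma four_block_mat_eqD:
  assumes eq: "four_block_mat X1 X2 X3 X4 = four_block_mat Y1 Y2 Y3 Y4"
    and X: "X1 \<in> carrier_mat r1 c1" "X2 \<in> carrier_mat r1 c2"
      "X3 \<in> carrier_mat r2 c1" "X4 \<in> carrier_mat r2 c2"
    and Y: "Y1 \<in> carrier_mat r1 c1" "Y2 \<in> carrier_mat r1 c2"
      "Y3 \<in> carrier_mat r2 c1" "Y4 \<in> carrier_mat r2 c2"
  shows "X1 = Y1" "X2 = Y2" "X3 = Y3" "X4 = Y4"
proof -
  have entry: "four_block_mat X1 X2 X3 X4 $$ (i, j) = four_block_mat Y1 Y2 Y3 Y4 $$ (i, j)" for i j
    by (simp add: eq)
  show "X1 = Y1"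
  proof (rule eq_matI)
    fix i j assume "i < dim_row Y1" "j < dim_col Y1"
    then show "X1 $$ (i, j) = Y1 $$ (i, j)" using entry[of i j] X Y by simp
  qed (use X Y in auto)
  show "X2 = Y2"
  proof (rule eq_matI)
    fix i j assume "i < dim_row Y2" "j < dim_col Y2"
    then show "X2 $$ (i, j) = Y2 $$ (i, j)" using entry[of i "c1 + j"] X Y by simp
  qed (use X Y in auto)
  show "X3 = Y3"
  proof (rule eq_matI)
    fix i j assume "i < dim_row Y3" "j < dim_col Y3"
    then show "X3 $$ (i, j) = Y3 $$ (i, j)" using entry[of "r1 + i" j] X Y by simp
  qed (use X Y in auto)
  show "X4 = Y4"
  proof (rule eq_matI)
    fix i j assume "i < dim_row Y4" "j < dim_col Y4"
    then show "X4 $$ (i, j) = Y4 $$ (i, j)" using entry[of "r1 + i" "c1 + j"] X Y by simp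
  qed (use X Y in auto)
qed

text \<open>Used to clear the minus signs from the block equations of the SLP constraints and of the
  Bezout identity.\<close>

lemma minus_mult_mat_eq_iff:
  fixes X Y Z :: "'a::ring mat"
  assumes "X \<in> carrier_mat r s" "Y \<in> carrier_mat s c" "Z \<in> carrier_mat r c" "T \<in> carrier_mat r c"
  shows "T + (- X) * Y = Z \<longleftrightarrow> T = Z + X * Y"
    and "(- X) * Y + T = Z \<longleftrightarrow> T = Z + X * Y"
    and "T + X * (- Y) = Z \<longleftrightarrow> T = Z + X * Y"
proof -
  have XY: "X * Y \<in> carrier_mat r c" using assms by simp
  have neg: "(- X) * Y = - (X * Y)" "X * (- Y) = - (X * Y)"
    using assms by simp_all
  have "T + - U = Z \<longleftrightarrow> T = Z + U" and "- U + T = Z \<longleftrightarrow> T = Z + U" if "U \<in> carrier_mat r c" for U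
    using that assms(3,4) by (auto simp: mat_eq_iff algebra_simps)
  from this[OF XY] show "T + (- X) * Y = Z \<longleftrightarrow> T = Z + X * Y"
    and "(- X) * Y + T = Z \<longleftrightarrow> T = Z + X * Y"
    and "T + X * (- Y) = Z \<longleftrightarrow> T = Z + X * Y"
    by (simp_all add: neg)
qed

lemma mat_add_minus_assoc:
  fixes X Y Z :: "'a::ab_group_add mat"
  shows "dim_row X = dim_row Y \<Longrightarrow> dim_col X = dim_col Y \<Longrightarrow> dim_row Y = dim_row Z \<Longrightarrow>
    dim_col Y = dim_col Z \<Longrightarrow> X + Y - Z = X + (Y - Z)"
  by (intro eq_matI) auto

lemma invertible_mat_factors:
  fixes X Y :: "'a::field mat"
  assumes "X \<in> carrier_mat k k" "Y \<in> carrier_mat k k" "invertible_mat (X * Y)"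
  shows "invertible_mat Y"
proof -
  have "det (X * Y) \<noteq> 0"
    using assms(3) invertible_mat_iff_det[of "X * Y" k] assms(1,2) by auto
  then show ?thesis
    using assms(1,2) by (simp add: det_mult[OF assms(1,2)] invertible_mat_iff_det[OF assms(2)])
qed

subsection \<open>SLP constraints and stability criteria\<close>

text \<open>Replaces the two block identities by four equations between their blocks, the form used
  from here on.\<close>

lemma slp_constraints_iff:
  assumes A: "A \<in> carrier_mat n n" and B: "B2 \<in> carrier_mat n m" and C: "C2 \<in> carrier_mat p n"
  shows "slp_constraints n m p A B2 C2 R M N L \<longleftrightarrow>
    R \<in> sRH_inf n n \<and> M \<in> sRH_inf m n \<and> N \<in> sRH_inf n p \<and> L \<in> RH_inf m p \<and>
    zI_minus A * R = 1\<^sub>m n + const_tm B2 * M \<and> zI_minus A * N = const_tm B2 * L \<and>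
    R * zI_minus A = 1\<^sub>m n + N * const_tm C2 \<and> M * zI_minus A = L * const_tm C2"
\<comment> \<open>If a membership fails, both sides are false; otherwise the memberships supply the
  sizes for block multiplication.\<close>
proof (cases "R \<in> sRH_inf n n \<and> M \<in> sRH_inf m n \<and> N \<in> sRH_inf n p \<and> L \<in> RH_inf m p")
  case True
  define W b c where W: "W = zI_minus A" and b: "b = const_tm B2" and c: "c = const_tm C2"
  have cd: "R \<in> carrier_mat n n" "M \<in> carrier_mat m n" "N \<in> carrier_mat n p"
    "L \<in> carrier_mat m p" "W \<in> carrier_mat n n" "b \<in> carrier_mat n m" "c \<in> carrier_mat p n"
    using True A B C by (auto simp: sRH_inf_eq RH_inf_eq stable_mats_carrier W b c)
  \<comment> \<open>A block row is a four-block matrix with empty lower blocks, so the block product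
    formula applies with a size 0.\<close>
  have "(W @\<^sub>c - b) * four_block_mat R N M L =
      four_block_mat (W * R + (- b) * M) (W * N + (- b) * L) (0\<^sub>m 0 n) (0\<^sub>m 0 p)"
    using cd unfolding append_cols_def
    by (subst mult_four_block_mat[of _ n n _ m _ 0 _ _ n _ p]) auto
  moreover have "(1\<^sub>m n :: ratfun mat) @\<^sub>c 0\<^sub>m n p = four_block_mat (1\<^sub>m n) (0\<^sub>m n p) (0\<^sub>m 0 n) (0\<^sub>m 0 p)"
    by (simp add: append_cols_def)
  ultimately have 1: "(W @\<^sub>c - b) * four_block_mat R N M L = 1\<^sub>m n @\<^sub>c 0\<^sub>m n p \<longleftrightarrow>
      W * R + (- b) * M = 1\<^sub>m n \<and> W * N + (- b) * L = 0\<^sub>m n p"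
    using cd
      four_block_mat_eqD(1,2)[of "W * R + (- b) * M" "W * N + (- b) * L" "0\<^sub>m 0 n" "0\<^sub>m 0 p"
        "1\<^sub>m n" "0\<^sub>m n p" "0\<^sub>m 0 n" "0\<^sub>m 0 p" n n p 0]
    by (auto simp del: uminus_mult_left_mat uminus_mult_right_mat)
  have "four_block_mat R N M L * (W @\<^sub>r - c) =
      four_block_mat (R * W + N * (- c)) (0\<^sub>m n 0) (M * W + L * (- c)) (0\<^sub>m m 0)"
    using cd unfolding append_rows_def
    by (subst mult_four_block_mat[of _ n n _ p _ m _ _ n _ 0]) auto
  moreover have "(1\<^sub>m n :: ratfun mat) @\<^sub>r 0\<^sub>m m n = four_block_mat (1\<^sub>m n) (0\<^sub>m n 0) (0\<^sub>m m n) (0\<^sub>m m 0)"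
    by (simp add: append_rows_def)
  ultimately have 2: "four_block_mat R N M L * (W @\<^sub>r - c) = 1\<^sub>m n @\<^sub>r 0\<^sub>m m n \<longleftrightarrow>
      R * W + N * (- c) = 1\<^sub>m n \<and> M * W + L * (- c) = 0\<^sub>m m n"
    using cd
      four_block_mat_eqD(1,3)[of "R * W + N * (- c)" "0\<^sub>m n 0" "M * W + L * (- c)" "0\<^sub>m m 0"
        "1\<^sub>m n" "0\<^sub>m n 0" "0\<^sub>m m n" "0\<^sub>m m 0" n n 0 m]
    by (auto simp del: uminus_mult_left_mat uminus_mult_right_mat)
  have "W * R + (- b) * M = 1\<^sub>m n \<longleftrightarrow> W * R = 1\<^sub>m n + b * M"
    using cd by (intro minus_mult_mat_eq_iff[of _ n m _ n]) auto
  moreover have "W * N + (- b) * L = 0\<^sub>m n p \<longleftrightarrow> W * N = b * L"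
    using cd minus_mult_mat_eq_iff(1)[of b n m L p "0\<^sub>m n p" "W * N"] by auto
  moreover have "R * W + N * (- c) = 1\<^sub>m n \<longleftrightarrow> R * W = 1\<^sub>m n + N * c"
    using cd by (intro minus_mult_mat_eq_iff[of _ n p _ n]) auto
  moreover have "M * W + L * (- c) = 0\<^sub>m m n \<longleftrightarrow> M * W = L * c"
    using cd minus_mult_mat_eq_iff(3)[of L m p c n "0\<^sub>m m n" "M * W"] by auto
  ultimately show ?thesis
    using 1 2 True unfolding slp_constraints_def W b c by blast
qed (auto simp: slp_constraints_def)

text \<open>With \<open>K = A + B2 * F\<close>, the product \<open>Y * zI_minus K\<close> combines
  the two stable products. Multiplying it by the stable, strictly proper inverse of
  \<open>zI_minus K\<close> returns \<open>Y\<close>.\<close>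

lemma stable_of_stabilizable:
  assumes A: "A \<in> carrier_mat n n" and B: "B2 \<in> carrier_mat n m" and stab: "stabilizable A B2"
    and Y: "Y \<in> carrier_mat q n"
    and YW: "Y * zI_minus A \<in> stable_mats 0 q n" and YB: "Y * const_tm B2 \<in> stable_mats 0 q m"
  shows "Y \<in> stable_mats (-1) q n"
proof -
  obtain F where F: "F \<in> carrier_mat m n" and schur: "schur_stable (A + B2 * F)"
    using stab A B unfolding stabilizable_def by auto
  define K where "K = A + B2 * F"
  define \<Phi> where "\<Phi> = mat_inv (zI_minus K)"
  have K: "K \<in> carrier_mat n n" using A B F by (simp add: K_def)
  note \<Phi> = mat_inv_props[OF zI_minus_carrier[OF K] zI_minus_invertible[OF K], folded \<Phi>_def]
  have "const_tm K = const_tm A + const_tm B2 * const_tm F"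
    using A B F by (simp add: K_def const_tm_add[of _ n n] const_tm_mult[of _ n m _ n])
  then have "zI_minus K = zI_minus A - const_tm B2 * const_tm F"
    using A B F K by (intro eq_matI) (auto simp: zI_minus_def simp del: index_mult_mat(1))
  then have "Y * zI_minus K = Y * zI_minus A - Y * const_tm B2 * const_tm F"
    using A B F Y by (simp add: mat_ring)
  moreover have "Y * const_tm B2 * const_tm F \<in> stable_mats 0 q n"
    using stable_mats_mult[OF YB const_tm_stable_mats[OF F]] by simp
  ultimately have "Y * zI_minus K \<in> stable_mats 0 q n"
    using YW by (simp add: stable_mats_minus)
  from stable_mats_mult[OF this mat_inv_zI_minus_stable[OF K schur[folded K_def]]]
  have "Y * zI_minus K * \<Phi> \<in> stable_mats (-1) q n" by (simp add: \<Phi>_def)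
  moreover have "Y * zI_minus K * \<Phi> = Y"
    using Y K \<Phi> by (simp add: mat_ring)
  ultimately show ?thesis by simp
qed

text \<open>The mirror image, with output injection \<open>H\<close> and multiplication from the
  left.\<close>

lemma stable_of_detectable:
  assumes A: "A \<in> carrier_mat n n" and C: "C2 \<in> carrier_mat p n" and det: "detectable A C2"
    and Y: "Y \<in> carrier_mat n q"
    and WY: "zI_minus A * Y \<in> stable_mats 0 n q" and CY: "const_tm C2 * Y \<in> stable_mats 0 p q"
  shows "Y \<in> stable_mats (-1) n q"
proof -
  obtain H where H: "H \<in> carrier_mat n p" and schur: "schur_stable (A + H * C2)"
    using det A C unfolding detectable_def by auto
  define K where "K = A + H * C2"
  define \<Phi> where "\<Phi> = mat_inv (zI_minus K)"
  have K: "K \<in> carrier_mat n n" using A C H by (simp add: K_def)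
  note \<Phi> = mat_inv_props[OF zI_minus_carrier[OF K] zI_minus_invertible[OF K], folded \<Phi>_def]
  have "const_tm K = const_tm A + const_tm H * const_tm C2"
    using A C H by (simp add: K_def const_tm_add[of _ n n] const_tm_mult[of _ n p _ n])
  then have "zI_minus K = zI_minus A - const_tm H * const_tm C2"
    using A C H K by (intro eq_matI) (auto simp: zI_minus_def simp del: index_mult_mat(1))
  then have "zI_minus K * Y = zI_minus A * Y - const_tm H * (const_tm C2 * Y)"
    using A C H Y by (simp add: mat_ring)
  moreover have "const_tm H * (const_tm C2 * Y) \<in> stable_mats 0 n q"
    using stable_mats_mult[OF const_tm_stable_mats[OF H] CY] by simp
  ultimately have "zI_minus K * Y \<in> stable_mats 0 n q"
    using WY by (simp add: stable_mats_minus)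
  from stable_mats_mult[OF mat_inv_zI_minus_stable[OF K schur[folded K_def]] this]
  have "\<Phi> * (zI_minus K * Y) \<in> stable_mats (-1) n q" by (simp add: \<Phi>_def)
  moreover have "\<Phi> * (zI_minus K * Y) = Y"
    using Y K \<Phi> mat_mult_eq_assoc[OF \<Phi>(3), of Y] by (simp add: mat_ring)
  ultimately show ?thesis by simp
qed

subsection \<open>Algebra of a doubly-coprime factorization\<close>

text \<open>Isolates the pure algebra, valid over any field, from questions of stability;
  \<open>W\<close> stands for \<open>zI - A\<close> and \<Phi> for its inverse.\<close>

locale coprime_factorization =
  fixes n m p :: nat and W \<Phi> B C Ul Vl Nl Ml Ur Vr Nr Mr :: "'a::field mat"
  assumes carrier:
      "W \<in> carrier_mat n n" "\<Phi> \<in> carrier_mat n n" "B \<in> carrier_mat n m" "C \<in> carrier_mat p n"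
      "Ul \<in> carrier_mat m m" "Vl \<in> carrier_mat m p" "Nl \<in> carrier_mat p m" "Ml \<in> carrier_mat p p"
      "Ur \<in> carrier_mat p p" "Vr \<in> carrier_mat m p" "Nr \<in> carrier_mat p m" "Mr \<in> carrier_mat m m"
    and W\<Phi>: "W * \<Phi> = 1\<^sub>m n" and \<Phi>W: "\<Phi> * W = 1\<^sub>m n"
    and Mr_inv: "invertible_mat Mr" and Nr: "C * \<Phi> * B = Nr * mat_inv Mr"
    and Ml_inv: "invertible_mat Ml" and Nl: "C * \<Phi> * B = mat_inv Ml * Nl"
    and bezout: "four_block_mat Ul (- Vl) (- Nl) Ml * four_block_mat Mr Vr Nr Ur = 1\<^sub>m (m + p)"
begin

lemma dims [simp]:
  "dim_row W = n" "dim_col W = n" "dim_row \<Phi> = n" "dim_col \<Phi> = n"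
  "dim_row B = n" "dim_col B = m" "dim_row C = p" "dim_col C = n"
  "dim_row Ul = m" "dim_col Ul = m" "dim_row Vl = m" "dim_col Vl = p"
  "dim_row Nl = p" "dim_col Nl = m" "dim_row Ml = p" "dim_col Ml = p"
  "dim_row Ur = p" "dim_col Ur = p" "dim_row Vr = m" "dim_col Vr = p"
  "dim_row Nr = p" "dim_col Nr = m" "dim_row Mr = m" "dim_col Mr = m"
  using carrier by auto

text \<open>This and its left counterpart restate the factorizations without inverses, in the
  right-nested shape that rewriting produces.\<close>

lemma Nr_eq: "C * (\<Phi> * (B * Mr)) = Nr"
proof -
  note inv = mat_inv_props[OF carrier(12) Mr_inv]
  have "C * (\<Phi> * (B * Mr)) = Nr * mat_inv Mr * Mr" by (simp add: Nr[symmetric] mat_ring)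
  also have "\<dots> = Nr" using inv by (simp add: mat_ring)
  finally show ?thesis .
qed

lemma Nl_eq: "Ml * (C * (\<Phi> * B)) = Nl"
proof -
  note inv = mat_inv_props[OF carrier(8) Ml_inv]
  have "Ml * (C * (\<Phi> * B)) = Ml * (mat_inv Ml * Nl)" by (simp add: Nl[symmetric] mat_ring)
  also have "\<dots> = Nl" using inv mat_mult_eq_assoc[OF inv(2), of Nl] by (simp add: mat_ring)
  finally show ?thesis .
qed

lemma bezout_left: "Ml * Nr = Nl * Mr" "Ml * Ur = 1\<^sub>m p + Nl * Vr"
proof -
  have "four_block_mat (Ul * Mr + (- Vl) * Nr) (Ul * Vr + (- Vl) * Ur)
      ((- Nl) * Mr + Ml * Nr) ((- Nl) * Vr + Ml * Ur) =
      four_block_mat (1\<^sub>m m) (0\<^sub>m m p) (0\<^sub>m p m) (1\<^sub>m p)"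
    using bezout carrier by (subst (asm) mult_four_block_mat[of _ m m _ p _ p _ _ m _ p]) simp_all
  from four_block_mat_eqD(3,4)[OF this, of m m p p]
  have "(- Nl) * Mr + Ml * Nr = 0\<^sub>m p m" "(- Nl) * Vr + Ml * Ur = 1\<^sub>m p"
    using carrier by (auto simp del: uminus_mult_left_mat)
  then show "Ml * Nr = Nl * Mr" "Ml * Ur = 1\<^sub>m p + Nl * Vr"
    using minus_mult_mat_eq_iff(2)[of Nl p m Mr m "0\<^sub>m p m" "Ml * Nr"]
      minus_mult_mat_eq_iff(2)[of Nl p m Vr p "1\<^sub>m p" "Ml * Ur"] carrier
    by (simp_all del: uminus_mult_left_mat)
qed

text \<open>A one-sided inverse of a square matrix over a field is two-sided, so the block factors
  may be swapped; these are blocks of the swapped product.\<close>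

lemma bezout_right:
  "Mr * Ul = 1\<^sub>m m + Vr * Nl" "Vr * Ml = Mr * Vl" "Ur * Ml = 1\<^sub>m p + Nr * Vl"
proof -
  have "four_block_mat Mr Vr Nr Ur * four_block_mat Ul (- Vl) (- Nl) Ml = 1\<^sub>m (m + p)"
    by (rule mat_mult_left_right_inverse[OF _ _ bezout]) (use carrier in auto)
  then have "four_block_mat (Mr * Ul + Vr * (- Nl)) (Mr * (- Vl) + Vr * Ml)
      (Nr * Ul + Ur * (- Nl)) (Nr * (- Vl) + Ur * Ml) =
      four_block_mat (1\<^sub>m m) (0\<^sub>m m p) (0\<^sub>m p m) (1\<^sub>m p)"
    using carrier by (subst (asm) mult_four_block_mat[of _ m m _ p _ p _ _ m _ p]) simp_all
  from four_block_mat_eqD[OF this, of m m p p]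
  have "Mr * Ul + Vr * (- Nl) = 1\<^sub>m m" "(- Mr) * Vl + Vr * Ml = 0\<^sub>m m p"
    "(- Nr) * Vl + Ur * Ml = 1\<^sub>m p"
    using carrier by simp_all
  then show "Mr * Ul = 1\<^sub>m m + Vr * Nl" "Vr * Ml = Mr * Vl" "Ur * Ml = 1\<^sub>m p + Nr * Vl"
    using minus_mult_mat_eq_iff(3)[of Vr m p Nl m "1\<^sub>m m" "Mr * Ul"]
      minus_mult_mat_eq_iff(2)[of Mr m m Vl p "0\<^sub>m m p" "Vr * Ml"]
      minus_mult_mat_eq_iff(2)[of Nr p m Vl p "1\<^sub>m p" "Ur * Ml"] carrier
    by (simp_all del: uminus_mult_left_mat uminus_mult_right_mat)
qed

text \<open>Gives the controller denominator the form identity plus \<open>Nl\<close> times a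
  factor, whose invertibility follows once \<open>Nl\<close> is strictly proper.\<close>

lemma Ml_denominator:
  assumes "Q \<in> carrier_mat m p"
  shows "Ml * (Ur - Nr * Q) = 1\<^sub>m p + Nl * (Vr - Mr * Q)"
proof -
  have "Ml * (Nr * Q) = Nl * (Mr * Q)"
    using assms mat_mult_eq_assoc[OF bezout_left(1), of Q] by (simp add: mat_ring)
  then show ?thesis using assms by (simp add: mat_ring bezout_left(2) mat_add_minus_assoc)
qed

text \<open>The equations hold for every \<open>L\<close>; the special form
  \<open>(Vr - Mr * Q) * Ml\<close> matters only for stability.\<close>

lemma slp_of_L:
  assumes "L \<in> carrier_mat m p"
    and "R = \<Phi> + \<Phi> * (B * (L * (C * \<Phi>)))" "M = L * (C * \<Phi>)" "N = \<Phi> * (B * L)"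
  shows "W * R = 1\<^sub>m n + B * M" "W * N = B * L" "R * W = 1\<^sub>m n + N * C" "M * W = L * C"
proof -
  have dL [simp]: "dim_row L = m" "dim_col L = p" using assms(1) by auto
  show "W * R = 1\<^sub>m n + B * M" "W * N = B * L" "R * W = 1\<^sub>m n + N * C" "M * W = L * C"
    unfolding assms(2-4) by (simp_all add: mat_ring W\<Phi> \<Phi>W mat_mult_eq_assoc[OF W\<Phi>])
qed

section \<open>Consequences of the SLP equations\<close>

context
  fixes R M N L :: "'a mat"
  assumes slp_carrier: "R \<in> carrier_mat n n" "M \<in> carrier_mat m n" "N \<in> carrier_mat n p"
      "L \<in> carrier_mat m p"
    and slp: "W * R = 1\<^sub>m n + B * M" "W * N = B * L" "M * W = L * C"
begin

lemma slp_dims: 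
  "dim_row R = n" "dim_col R = n" "dim_row M = m" "dim_col M = n"
  "dim_row N = n" "dim_col N = p" "dim_row L = m" "dim_col L = p"
  using slp_carrier by auto

lemma M_eq: "M = L * (C * \<Phi>)"
proof -
  have "M = M * (W * \<Phi>)" by (simp add: W\<Phi> mat_ring slp_dims)
  also have "\<dots> = M * W * \<Phi>" by (simp add: mat_ring slp_dims)
  finally show ?thesis by (simp add: slp mat_ring slp_dims)
qed

lemma N_eq: "N = \<Phi> * (B * L)"
proof -
  have "N = \<Phi> * W * N" by (simp add: \<Phi>W mat_ring slp_dims)
  also have "\<dots> = \<Phi> * (W * N)" by (simp add: mat_ring slp_dims)
  finally show ?thesis by (simp add: slp)
qed

lemma R_eq: "R = \<Phi> + \<Phi> * (B * M)"
proof -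
  have "R = \<Phi> * W * R" by (simp add: \<Phi>W mat_ring slp_dims)
  also have "\<dots> = \<Phi> * (W * R)" by (simp add: mat_ring slp_dims)
  finally show ?thesis by (simp add: slp mat_ring slp_dims)
qed

text \<open>Multiplying the asserted equation by \<open>D\<close> removes both inverses, since \<open>R B E = N D\<close>.\<close>

lemma controller_eq:
  assumes E: "E \<in> carrier_mat m p" and D: "D \<in> carrier_mat p p"
    and L: "L = E * Ml" and MlD: "Ml * D = 1\<^sub>m p + Nl * E"
    and R: "invertible_mat R" and Di: "invertible_mat D"
  shows "L - M * mat_inv R * N = E * mat_inv D"
proof -
  note Ri = mat_inv_props[OF slp_carrier(1) R] and Dinv = mat_inv_props[OF D Di]
  have [simp]: "dim_row E = m" "dim_col E = p" "dim_row D = p" "dim_col D = p"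
    "dim_row (mat_inv R) = n" "dim_col (mat_inv R) = n"
    "dim_row (mat_inv D) = p" "dim_col (mat_inv D) = p"
    using E D Ri Dinv by auto
  \<comment> \<open>Writing \<open>Nl\<close> as \<open>Ml * (C * (\<Phi> * B))\<close> exposes the
    factor \<open>Ml\<close>, so that after multiplication by \<open>E\<close> the product
    \<open>L\<close> reappears.\<close>
  have MlD': "Ml * D = 1\<^sub>m p + Ml * (C * (\<Phi> * (B * E)))"
    by (simp add: MlD Nl_eq[symmetric] mat_ring)
  have LD: "L * D = E + M * (B * E)"
    by (simp add: L M_eq mat_ring MlD')
  \<comment> \<open>Both sides expand to
    \<open>\<Phi> B E + \<Phi> B E Ml C \<Phi> B E\<close>.\<close>
  have "R * (B * E) = N * D"
    by (simp add: R_eq M_eq N_eq L mat_ring MlD')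
  then have "mat_inv R * (N * D) = mat_inv R * R * (B * E)"
    by (simp add: mat_ring slp_dims)
  also have "\<dots> = B * E" by (simp add: Ri mat_ring)
  finally have "(L - M * mat_inv R * N) * D = L * D - M * (B * E)"
    by (simp add: mat_ring slp_dims)
  also have "\<dots> = E"
    unfolding LD by (intro eq_matI) (auto simp: slp_dims simp del: index_mult_mat(1))
  finally have "(L - M * mat_inv R * N) * D * mat_inv D = E * mat_inv D" by simp
  then show ?thesis by (simp add: mat_assoc[of _ D] Dinv mat_one_right slp_dims)
qed

text \<open>Multiplying \<open>Q\<close> by \<open>Mr\<close> and using \<open>Mr Vl = Vr Ml\<close>
  and \<open>Mr Ul = I + Vr Nl\<close> cancels most terms, leaving
  \<open>Vr - Mr Q = L Ur - M B Vr\<close>. Multiplication by \<open>Ml\<close> then recovers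
  \<open>L\<close>.\<close>

lemma L_of_Q:
  assumes Q: "Q = Vl * C * N * Ur - Ul * L * Ur - Vl * C * R * B * Vr + Ul * M * B * Vr + Ul * Vr"
  shows "L = (Vr - Mr * Q) * Ml"
proof -
  note [simp] = slp_dims
  have MrVl: "Mr * (Vl * X) = Vr * (Ml * X)" if "dim_row X = p" for X
    using mat_mult_eq_assoc[OF bezout_right(2)[symmetric], of X] that by (simp add: mat_ring)
  have MrUl: "Mr * (Ul * X) = X + Vr * (Ml * (C * (\<Phi> * (B * X))))" if "dim_row X = m" for X
    using mat_mult_eq_assoc[OF bezout_right(1), of X] that
    by (simp add: mat_ring Nl_eq[symmetric])
  \<comment> \<open>The three terms that cancel in \<open>Vr - Mr * Q\<close>; naming them keeps
    them atomic in the entrywise comparison.\<close>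
  define x where "x = Mr * (Vl * (C * (N * Ur)))"
  define y where "y = Vr * (Ml * (C * (\<Phi> * (B * (M * (B * Vr))))))"
  define z where "z = Vr * (Ml * (C * (\<Phi> * (B * Vr))))"
  have d: "dim_row x = m" "dim_col x = p" "dim_row y = m" "dim_col y = p"
    "dim_row z = m" "dim_col z = p"
    by (simp_all add: x_def y_def z_def)
  have "Mr * (Ul * (L * Ur)) = L * Ur + x"
    by (simp add: MrUl x_def MrVl N_eq mat_ring)
  moreover have "Mr * (Vl * (C * (R * (B * Vr)))) = z + y"
    by (simp add: R_eq MrVl y_def z_def mat_ring)
  moreover have "Mr * (Ul * (M * (B * Vr))) = M * (B * Vr) + y"
    by (simp add: MrUl y_def)
  moreover have "Mr * (Ul * Vr) = Vr + z"
    by (simp add: MrUl z_def)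
  ultimately have "Mr * Q = x - (L * Ur + x) - (z + y) + (M * (B * Vr) + y) + (Vr + z)"
    by (simp add: Q mat_ring x_def)
  then have "Vr - Mr * Q = L * Ur - M * (B * Vr)"
    by (intro eq_matI) (auto simp: d simp del: index_mult_mat(1))
  then have "(Vr - Mr * Q) * Ml = L * (Ur * Ml) - L * (C * (\<Phi> * (B * (Vr * Ml))))"
    by (simp add: M_eq mat_ring)
  \<comment> \<open>Here \<open>Ur Ml = I + Nr Vl\<close>, and
    \<open>Nr Vl = C \<Phi> B Mr Vl = C \<Phi> B Vr Ml\<close>.\<close>
  also have "L * (Ur * Ml) = L + L * (C * (\<Phi> * (B * (Vr * Ml))))"
    by (simp add: bezout_right Nr_eq[symmetric] mat_ring)
  finally show ?thesis
    by (intro eq_matI) (auto simp del: index_mult_mat(1))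
qed

end

end

subsection \<open>Parametrization\<close>

lemma RH_inf_ops:
  "X \<in> RH_inf r c \<Longrightarrow> Y \<in> RH_inf r c \<Longrightarrow> X + Y \<in> RH_inf r c"
  "X \<in> RH_inf r c \<Longrightarrow> Y \<in> RH_inf r c \<Longrightarrow> X - Y \<in> RH_inf r c"
  by (simp_all add: RH_inf_eq stable_mats_add stable_mats_minus)

lemma RH_inf_mult: "X \<in> RH_inf r s \<Longrightarrow> Y \<in> RH_inf s c \<Longrightarrow> X * Y \<in> RH_inf r c"
  unfolding RH_inf_eq using stable_mats_mult[of X 0 r s Y 0 c] by simp

lemma sRH_inf_mult:
  "X \<in> sRH_inf r s \<Longrightarrow> Y \<in> RH_inf s c \<Longrightarrow> X * Y \<in> sRH_inf r c"
  "X' \<in> RH_inf r s \<Longrightarrow> Y' \<in> sRH_inf s c \<Longrightarrow> X' * Y' \<in> sRH_inf r c"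
  unfolding RH_inf_eq sRH_inf_eq
  using stable_mats_mult[of X "-1" r s Y 0 c] stable_mats_mult[of X' 0 r s Y' "-1" c] by simp_all

lemma sRH_inf_subset: "X \<in> sRH_inf r c \<Longrightarrow> X \<in> RH_inf r c"
  by (auto simp: RH_inf_eq sRH_inf_eq intro: stable_mats_mono)

lemma sRH_inf_diff: "X \<in> sRH_inf r c \<Longrightarrow> Y \<in> sRH_inf r c \<Longrightarrow> X - Y \<in> sRH_inf r c"
  by (simp add: sRH_inf_eq stable_mats_minus)

lemma RH_inf_carrier: "X \<in> RH_inf r c \<Longrightarrow> X \<in> carrier_mat r c"
  by (simp add: RH_inf_def)

lemma sRH_inf_carrier: "X \<in> sRH_inf r c \<Longrightarrow> X \<in> carrier_mat r c"
  by (simp add: sRH_inf_def)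

lemma RH_inf_const: "X \<in> carrier_mat r c \<Longrightarrow> const_tm X \<in> RH_inf r c"
  by (simp add: RH_inf_eq const_tm_stable_mats)

lemma RH_inf_one: "1\<^sub>m r \<in> RH_inf r r"
  by (simp add: RH_inf_eq one_stable_mats)

section \<open>Stability of the parametrized closed-loop maps\<close>

locale plant =
  fixes A B2 C2 :: "real mat"
    and Ul Vl Nl Ml Ur Vr Nr Mr :: "ratfun mat"
    and n m p :: nat
  assumes A: "A \<in> carrier_mat n n" and B2: "B2 \<in> carrier_mat n m" and C2: "C2 \<in> carrier_mat p n"
    and stabilizable: "stabilizable A B2" and detectable: "detectable A C2"
    and dcf: "doubly_coprime_factorization p m (const_tm C2 * mat_inv (zI_minus A) * const_tm B2)
           Ul Vl Nl Ml Ur Vr Nr Mr"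
begin

abbreviation "W \<equiv> zI_minus A"
abbreviation "\<Phi> \<equiv> mat_inv W"
abbreviation "B \<equiv> const_tm B2"
abbreviation "C \<equiv> const_tm C2"

lemma plant_dims [simp]:
  "dim_row A = n" "dim_col A = n" "dim_row B2 = n" "dim_col B2 = m" "dim_row C2 = p" "dim_col C2 = n"
  using A B2 C2 by auto

lemmas \<Phi>_props = mat_inv_props[OF zI_minus_carrier[OF A] zI_minus_invertible[OF A]]

lemma factors:
  "Ul \<in> RH_inf m m" "Vl \<in> RH_inf m p" "Nl \<in> RH_inf p m" "Ml \<in> RH_inf p p"
  "Ur \<in> RH_inf p p" "Vr \<in> RH_inf m p" "Nr \<in> RH_inf p m" "Mr \<in> RH_inf m m"
  "B \<in> RH_inf n m" "C \<in> RH_inf p n"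
  using dcf RH_inf_const[OF B2] RH_inf_const[OF C2]
  by (auto simp: doubly_coprime_factorization_def)

sublocale coprime_factorization n m p W \<Phi> B C Ul Vl Nl Ml Ur Vr Nr Mr
  using dcf[unfolded doubly_coprime_factorization_def] zI_minus_carrier[OF A]
    factors[THEN RH_inf_carrier] \<Phi>_props
  by unfold_locales blast+

text \<open>Although \<Phi> itself may be unstable, multiplication on the right by \<open>W\<close>
  gives \<open>Ml * C\<close> and by \<open>B\<close> gives \<open>Nl\<close>, both stable.\<close>

lemma MlC\<Phi>: "Ml * (C * \<Phi>) \<in> sRH_inf p n"
  unfolding sRH_inf_eq
proof (rule stable_of_stabilizable[OF A B2 stabilizable])
  have "Ml * (C * \<Phi>) * W = Ml * C" by (simp add: mat_ring \<Phi>W)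
  then show "Ml * (C * \<Phi>) * W \<in> stable_mats 0 p n"
    using RH_inf_mult[OF factors(4,10)] by (simp add: RH_inf_eq)
  have "Ml * (C * \<Phi>) * B = Nl" using Nl_eq by (simp add: mat_ring)
  then show "Ml * (C * \<Phi>) * B \<in> stable_mats 0 p m"
    using factors(3) by (simp add: RH_inf_eq)
qed (use carrier in simp)

text \<open>Dually, multiplication on the left by \<open>W\<close> gives \<open>B * Mr\<close> and
  by \<open>C\<close> gives \<open>Nr\<close>.\<close>

lemma \<Phi>BMr: "\<Phi> * (B * Mr) \<in> sRH_inf n m"
  unfolding sRH_inf_eq
proof (rule stable_of_detectable[OF A C2 detectable])
  have "W * (\<Phi> * (B * Mr)) = B * Mr"
    by (simp add: mat_mult_eq_assoc[OF W\<Phi>] mat_ring)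
  then show "W * (\<Phi> * (B * Mr)) \<in> stable_mats 0 n m"
    using RH_inf_mult[OF factors(9,8)] by (simp add: RH_inf_eq)
  show "C * (\<Phi> * (B * Mr)) \<in> stable_mats 0 p m"
    using factors(7) by (simp add: RH_inf_eq Nr_eq)
qed (use carrier in simp)

lemma Nl_strictly_proper: "Nl \<in> sRH_inf p m"
  using sRH_inf_mult(1)[OF MlC\<Phi> factors(9)] by (simp add: mat_ring Nl_eq)

text \<open>The detectability criterion applies to this sum although its summands may be unstable:
  \<open>C\<close> maps it to \<open>(I + N\<^sub>r V\<^sub>l) C \<Phi> = U\<^sub>r M\<^sub>l C \<Phi>\<close>.\<close>

lemma central_R: "\<Phi> + \<Phi> * (B * (Vr * (Ml * (C * \<Phi>)))) \<in> sRH_inf n n" (is "?Y \<in> _")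
  unfolding sRH_inf_eq
proof (rule stable_of_detectable[OF A C2 detectable])
  have "W * ?Y = 1\<^sub>m n + B * (Vr * (Ml * (C * \<Phi>)))"
    by (simp add: mat_mult_eq_assoc[OF W\<Phi>] W\<Phi> mat_ring)
  then show "W * ?Y \<in> stable_mats 0 n n"
    using RH_inf_ops(1)[OF RH_inf_one RH_inf_mult[OF factors(9)
        RH_inf_mult[OF factors(6) sRH_inf_subset[OF MlC\<Phi>]]]]
    by (simp add: RH_inf_eq)
  have "Vr * (Ml * (C * \<Phi>)) = Mr * (Vl * (C * \<Phi>))"
    using mat_mult_eq_assoc[OF bezout_right(2), of "C * \<Phi>"] by (simp add: mat_ring)
  then have "C * ?Y = C * \<Phi> + C * (\<Phi> * (B * Mr)) * (Vl * (C * \<Phi>))"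
    by (simp add: mat_ring)
  also have "\<dots> = Ur * (Ml * (C * \<Phi>))"
    using mat_mult_eq_assoc[OF bezout_right(3), of "C * \<Phi>"] by (simp add: Nr_eq mat_ring)
  finally show "C * ?Y \<in> stable_mats 0 p n"
    using RH_inf_mult[OF factors(5) sRH_inf_subset[OF MlC\<Phi>]] by (simp add: RH_inf_eq)
qed (use carrier in simp)

text \<open>The maps are affine in \<open>Q\<close>, and every \<open>Q\<close> term is enclosed in
  stable factors: \<open>N = (\<Phi> B Mr) (Vl - Q Ml)\<close>, and \<open>R\<close> is its value at
  \<open>Q = 0\<close> minus \<open>(\<Phi> B Mr) Q (Ml C \<Phi>)\<close>.\<close>

lemma slp_of_Q:
  assumes Q: "Q \<in> RH_inf m p"
  defines "L \<equiv> (Vr - Mr * Q) * Ml"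
  shows "slp_constraints n m p A B2 C2 (\<Phi> + \<Phi> * (B * (L * (C * \<Phi>)))) (L * (C * \<Phi>))
    (\<Phi> * (B * L)) L"
proof -
  have [simp]: "dim_row Q = m" "dim_col Q = p" using RH_inf_carrier[OF Q] by auto
  have E: "Vr - Mr * Q \<in> RH_inf m p"
    by (intro RH_inf_ops factors RH_inf_mult[OF factors(8) Q])
  have L: "L \<in> RH_inf m p" unfolding L_def by (rule RH_inf_mult[OF E factors(4)])
  have M: "L * (C * \<Phi>) \<in> sRH_inf m n"
    using sRH_inf_mult(2)[OF E MlC\<Phi>] by (simp add: L_def mat_ring)
  have "\<Phi> * (B * (Vr * Ml)) - \<Phi> * (B * (Mr * (Q * Ml))) = \<Phi> * (B * L)"
    by (simp add: L_def mat_ring)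
  \<comment> \<open>The identity \<open>Vr Ml = Mr Vl\<close> is what brings the stable factor
    \<open>\<Phi> B Mr\<close> to the front.\<close>
  moreover have "\<Phi> * (B * (Vr * Ml)) = \<Phi> * (B * Mr) * Vl"
    by (simp add: bezout_right(2) mat_ring)
  moreover have "\<Phi> * (B * (Mr * (Q * Ml))) = \<Phi> * (B * Mr) * (Q * Ml)"
    by (simp add: mat_ring)
  moreover have "\<Phi> * (B * Mr) * Vl - \<Phi> * (B * Mr) * (Q * Ml) \<in> sRH_inf n p"
    by (intro sRH_inf_diff sRH_inf_mult(1)[OF \<Phi>BMr] RH_inf_mult[OF Q factors(4)] factors)
  ultimately have N: "\<Phi> * (B * L) \<in> sRH_inf n p" by simp
  have "\<Phi> + \<Phi> * (B * (L * (C * \<Phi>))) = \<Phi> + \<Phi> * (B * (Vr * (Ml * (C * \<Phi>)))) -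
      \<Phi> * (B * Mr) * (Q * (Ml * (C * \<Phi>)))"
    by (simp add: L_def mat_ring mat_add_minus_assoc)
  moreover have "\<Phi> * (B * Mr) * (Q * (Ml * (C * \<Phi>))) \<in> sRH_inf n n"
    by (intro sRH_inf_mult(1)[OF \<Phi>BMr] RH_inf_mult[OF Q sRH_inf_subset[OF MlC\<Phi>]])
  ultimately have R: "\<Phi> + \<Phi> * (B * (L * (C * \<Phi>))) \<in> sRH_inf n n"
    using central_R by (simp add: sRH_inf_diff)
  show ?thesis
    unfolding slp_constraints_iff[OF A B2 C2]
    using R M N L slp_of_L[OF RH_inf_carrier[OF L] refl refl refl] by blast
qed

text \<open>Serves both directions: \<open>Q\<close> may be prescribed or constructed from the SLP
  data, the link being the formula for \<open>L\<close>.\<close>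

lemma slp_controller:
  assumes slp: "slp_constraints n m p A B2 C2 R M N L"
    and Q: "Q \<in> RH_inf m p" and L: "L = (Vr - Mr * Q) * Ml"
  shows "invertible_mat R" "invertible_mat (Ur - Nr * Q)"
    "L - M * mat_inv R * N = (Vr - Mr * Q) * mat_inv (Ur - Nr * Q)"
proof -
  note slp' = slp[unfolded slp_constraints_iff[OF A B2 C2]]
  have c: "R \<in> carrier_mat n n" "M \<in> carrier_mat m n" "N \<in> carrier_mat n p"
    "L \<in> carrier_mat m p" "Q \<in> carrier_mat m p"
    using slp' Q by (auto dest: sRH_inf_carrier RH_inf_carrier)
  have BM: "B * M \<in> sRH_inf n n"
    using slp' by (auto intro: sRH_inf_mult(2)[OF factors(9)])
  have "invertible_mat (W * R)"
    using slp' invertible_one_plus_strictly_proper[OF BM[unfolded sRH_inf_eq]] by simp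
  then show R: "invertible_mat R" using carrier(1) c(1) by (rule invertible_mat_factors[rotated 2])
  have E: "Vr - Mr * Q \<in> RH_inf m p" and D: "Ur - Nr * Q \<in> RH_inf p p"
    by (intro RH_inf_ops factors RH_inf_mult[OF factors(8) Q] RH_inf_mult[OF factors(7) Q])+
  have NlE: "Nl * (Vr - Mr * Q) \<in> sRH_inf p p"
    by (rule sRH_inf_mult(1)[OF Nl_strictly_proper E])
  note MlD = Ml_denominator[OF c(5)]
  have "invertible_mat (Ml * (Ur - Nr * Q))"
    using invertible_one_plus_strictly_proper[OF NlE[unfolded sRH_inf_eq]] by (simp add: MlD)
  then show Di: "invertible_mat (Ur - Nr * Q)"
    using carrier(8) RH_inf_carrier[OF D] by (rule invertible_mat_factors[rotated 2])
  show "L - M * mat_inv R * N = (Vr - Mr * Q) * mat_inv (Ur - Nr * Q)"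
    using slp' by (intro controller_eq[OF c(1-4) _ _ _ RH_inf_carrier[OF E] RH_inf_carrier[OF D]
          L MlD R Di]) auto
qed

text \<open>Membership is closure of \<open>RH_inf\<close> under sums, differences and products,
  strictly proper maps being in particular proper.\<close>

lemma Q_of_slp:
  assumes slp: "slp_constraints n m p A B2 C2 R M N L"
  defines "Q \<equiv> Vl * C * N * Ur - Ul * L * Ur - Vl * C * R * B * Vr + Ul * M * B * Vr + Ul * Vr"
  shows "Q \<in> RH_inf m p" "L = (Vr - Mr * Q) * Ml"
proof -
  note slp' = slp[unfolded slp_constraints_iff[OF A B2 C2]]
  have RH: "R \<in> RH_inf n n" "M \<in> RH_inf m n" "N \<in> RH_inf n p" "L \<in> RH_inf m p"
    using slp' by (auto intro: sRH_inf_subset)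
  show "Q \<in> RH_inf m p"
    unfolding Q_def
    by (intro RH_inf_ops RH_inf_mult[where s = m] RH_inf_mult[where s = n]
        RH_inf_mult[where s = p] factors RH)
  show "L = (Vr - Mr * Q) * Ml"
    using slp' by (intro L_of_Q[OF RH[THEN RH_inf_carrier]]) (auto simp: Q_def)
qed

end

theorem theorem3:
  fixes A B2 C2 :: "real mat"
    and Ul Vl Nl Ml Ur Vr Nr Mr :: "ratfun mat"
    and n m p :: nat
  assumes "A \<in> carrier_mat n n" and "B2 \<in> carrier_mat n m" and "C2 \<in> carrier_mat p n"
    and "stabilizable A B2" and "detectable A C2"
    and "doubly_coprime_factorization p m (const_tm C2 * mat_inv (zI_minus A) * const_tm B2)
           Ul Vl Nl Ml Ur Vr Nr Mr"
  shows
    "(\<forall>Q \<in> RH_inf m p.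
        let \<Phi> = mat_inv (zI_minus A); B = const_tm B2; C = const_tm C2;
            R = \<Phi> + \<Phi> * B * (Vr - Mr * Q) * Ml * C * \<Phi>;
            M = (Vr - Mr * Q) * Ml * C * \<Phi>;
            N = \<Phi> * B * (Vr - Mr * Q) * Ml;
            L = (Vr - Mr * Q) * Ml
        in slp_constraints n m p A B2 C2 R M N L \<and>
           invertible_mat R \<and> invertible_mat (Ur - Nr * Q) \<and>
           L - M * mat_inv R * N = (Vr - Mr * Q) * mat_inv (Ur - Nr * Q))
   \<and> (\<forall>R M N L. slp_constraints n m p A B2 C2 R M N L \<longrightarrow>
        (let B = const_tm B2; C = const_tm C2;
             Q = Vl * C * N * Ur - Ul * L * Ur - Vl * C * R * B * Vr + Ul * M * B * Vr + Ul * Vr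
         in Q \<in> RH_inf m p \<and>
            invertible_mat R \<and> invertible_mat (Ur - Nr * Q) \<and>
            (Vr - Mr * Q) * mat_inv (Ur - Nr * Q) = L - M * mat_inv R * N))"
proof -
  interpret plant A B2 C2 Ul Vl Nl Ml Ur Vr Nr Mr n m p
    using assms by unfold_locales
  show ?thesis
  proof (intro conjI ballI allI impI)
    fix Q assume Q: "Q \<in> RH_inf m p"
    define E where "E = Vr - Mr * Q"
    have [simp]: "dim_row E = m" "dim_col E = p"
      using RH_inf_carrier[OF Q] by (auto simp: E_def)
    \<comment> \<open>Reconciles the left-nested products of the theorem with the bracketing used in
      \<open>slp_of_Q\<close>.\<close>
    have eqs: "\<Phi> + \<Phi> * B * E * Ml * C * \<Phi> = \<Phi> + \<Phi> * (B * (E * Ml * (C * \<Phi>)))"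
      "E * Ml * C * \<Phi> = E * Ml * (C * \<Phi>)" "\<Phi> * B * E * Ml = \<Phi> * (B * (E * Ml))"
      by (simp_all add: mat_assoc)
    note slp = slp_of_Q[OF Q, folded E_def, folded eqs]
    show "let \<Phi> = mat_inv (zI_minus A); B = const_tm B2; C = const_tm C2;
            R = \<Phi> + \<Phi> * B * (Vr - Mr * Q) * Ml * C * \<Phi>;
            M = (Vr - Mr * Q) * Ml * C * \<Phi>;
            N = \<Phi> * B * (Vr - Mr * Q) * Ml;
            L = (Vr - Mr * Q) * Ml
        in slp_constraints n m p A B2 C2 R M N L \<and>
           invertible_mat R \<and> invertible_mat (Ur - Nr * Q) \<and>
           L - M * mat_inv R * N = (Vr - Mr * Q) * mat_inv (Ur - Nr * Q)"
      unfolding Let_def E_def[symmetric]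
      using slp slp_controller[OF slp Q, folded E_def, OF refl] by blast
  next
    fix R M N L assume slp: "slp_constraints n m p A B2 C2 R M N L"
    show "let B = const_tm B2; C = const_tm C2;
             Q = Vl * C * N * Ur - Ul * L * Ur - Vl * C * R * B * Vr + Ul * M * B * Vr + Ul * Vr
         in Q \<in> RH_inf m p \<and>
            invertible_mat R \<and> invertible_mat (Ur - Nr * Q) \<and>
            (Vr - Mr * Q) * mat_inv (Ur - Nr * Q) = L - M * mat_inv R * N"
      unfolding Let_def
      using Q_of_slp[OF slp] slp_controller[OF slp Q_of_slp[OF slp]] by simp
  qed
qed

end
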